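(* Let $K\ge 1$ be the number of workers, $\mathcal K=\{1,\dots,K\}$, and let $N\ge 1$ be an arbitrary number of files, $\mathcal N=\{1,\dots,N\}$, with an arbitrary popularity distribution $p_1\ge\dots\ge p_N$, $\sum_n p_n=1$. Let $M_1,\dots,M_K$ be positive integers (mapping loads) with $\sum_{k} M_k\ge N$, and let the index set $\mathcal Q=\{1,\dots,Q\}$ of target functions be partitioned as $\mathcal Q=\bigsqcup_{k\in\mathcal K}\mathcal W_k$, with (normalized) reducing loads $W_k=|\mathcal W_k|/Q$. Then the file placement strategy together with the nested coded shuffling strategy (both defined in the context) is valid for this system. That is, for every file placement $\{t_{n,\mathcal S}\}$ satisfying the placement constraints and every job with nonempty required file set $\mathcal D\subseteq\mathcal N$: (i) there exist shuffling parameters $\{L^{\mathcal D}_{j,\mathcal S}\}$, $\{r^{\mathcal S\setminus\{i\}}_{k,\mathcal S}(\mathcal D)\}$ satisfying the feasibility constraint of the nested coded shuffling strategy; and (ii) for any such parameters, the nested coded shuffling procedure can be carried out, and after it every worker $k\in\mathcal K$ can recover, from its locally computed intermediate values and the coded messages multicast by the other workers, all the intermediate values it needs and has not computed locally, namely $\{V_{q,n}: q\in\mathcal W_k,\ n\in\mathcal D,\ n\notin\mathcal M_k\}$ (where $\mathcal M_k$ is the set of files stored at worker $k$), whatever the values of the intermediate values are.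
   Context: **Setting (MapReduce-type distributed computing).** A job requires a nonempty set of files $\mathcal D\subseteq\mathcal N$ and has $Q$ target functions. For each $q\in\mathcal Q$ and $n\in\mathcal D$ there is an intermediate value (IV) $V_{q,n}$, a string of $T$ bits. It is computed locally by exactly those workers that store file $n$ (a worker storing $n$ computes $V_{q,n}$ for all $q\in\mathcal Q$). The target function $q$ is a function of $\{V_{q,n}:n\in\mathcal D\}$. Worker $k$ must compute the target functions in $\mathcal W_k$, so it needs all $V_{q,n}$ with $q\in\mathcal W_k$, $n\in\mathcal D$. **File placement strategy.** A placement is a family $t_{n,\mathcal S}\in\{0,1\}$, for $n\in\mathcal N$ and $\emptyset\ne\mathcal S\subseteq\mathcal K$, where $t_{n,\mathcal S}=1$ means that the set of all workers storing file $n$ is exactly $\mathcal S$. The placement constraints are $$\sum_{\emptyset\neq\mathcal S\subseteq\mathcal K}t_{n,\mathcal S}=1\ \ (n\in\mathcal N),\qquad \sum_{n=1}^N\ \sum_{\mathcal S\subseteq\mathcal K,\,k\in\mathcal S}t_{n,\mathcal S}\le M_k\ \ (k\in\mathcal K).$$ The set of files stored at worker $k$ is $\mathcal M_k=\{n: t_{n,\mathcal S}=1\text{ for some }\mathcal S\ni k\}$. For a job with file set $\mathcal D$, put $\mathcal A^{\mathcal D}_{\mathcal S}=\{n\in\mathcal D:t_{n,\mathcal S}=1\}$. **Shuffling parameters and feasibility constraint.** The parameters are reals $L^{\mathcal D}_{j,\mathcal S}\ge 0$ for $\mathcal S\subseteq\mathcal K$, $|\mathcal S|\ge 2$, $j\in\mathcal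 S$, and $r^{\mathcal S\setminus\{i\}}_{k,\mathcal S}(\mathcal D)\ge 0$ for $\mathcal S\subseteq\mathcal K$, $|\mathcal S|\ge 3$, $k\in\mathcal S$, $i\in\mathcal S\setminus\{k\}$ (by convention $r^{\mathcal S\setminus\{i\}}_{k,\mathcal S}(\mathcal D)=0$ when $|\mathcal S|=2$). They are sizes in bits normalized by $TQ$, and $TQ\,L^{\mathcal D}_{j,\mathcal S}$ and $TQ\,r^{\mathcal S\setminus\{i\}}_{k,\mathcal S}(\mathcal D)$ are required to be integers. The feasibility constraint is: for all $\mathcal S\subseteq\mathcal K$ with $|\mathcal S|\ge2$ and all $k\in\mathcal S$, $$W_k\sum_{n\in\mathcal D}t_{n,\mathcal S\setminus\{k\}}+\sum_{i\in\mathcal K\setminus\mathcal S}r^{\mathcal S}_{k,\mathcal S\cup\{i\}}(\mathcal D)=\sum_{j\in\mathcal S\setminus\{k\}}L^{\mathcal D}_{j,\mathcal S}+\sum_{i\in\mathcal S\setminus\{k\}}r^{\mathcal S\setminus\{i\}}_{k,\mathcal S}(\mathcal D).$$ **Nested coded shuffling procedure.** Process the subsets $\mathcal S\subseteq\mathcal K$ with $|\mathcal S|\ge2$ in order of decreasing size, starting from $\mathcal S=\mathcal K$. Sets of IVs below are treated at the level of individual bits of the IVs, and all workers know which bits are placed in which set. For each $\mathcal S$: 1. For each $k\in\mathcal S$, let $\mathcal V^{\mathcal D}_{k,\mathcal S\setminus\{k\}}$ be the bits of $\{V_{q,n}:q\in\mathcal W_k,\ n\in\mathcal A^{\mathcal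 D}_{\mathcal S\setminus\{k\}}\}$ and let $$\mathcal I^{\mathcal D}_{k,\mathcal S}=\mathcal V^{\mathcal D}_{k,\mathcal S\setminus\{k\}}\ \cup\ \bigcup_{i\in\mathcal K\setminus\mathcal S}\mathcal R^{\mathcal S}_{k,\mathcal S\cup\{i\}}(\mathcal D),$$ where the residual sets $\mathcal R^{\mathcal S}_{k,\mathcal S\cup\{i\}}(\mathcal D)$ were produced in step 2 when processing $\mathcal S\cup\{i\}$ (there are none for $\mathcal S=\mathcal K$). 2. For each $k\in\mathcal S$, partition $\mathcal I^{\mathcal D}_{k,\mathcal S}$ into sets $\mathcal I^{\mathcal D}_{k,\mathcal S|j}$, $j\in\mathcal S\setminus\{k\}$, consisting of bits computed locally by worker $j$ and having exactly $TQ\,L^{\mathcal D}_{j,\mathcal S}$ bits (the same size for every $k\in\mathcal S\setminus\{j\}$), and residual sets $\mathcal R^{\mathcal S\setminus\{i\}}_{k,\mathcal S}(\mathcal D)$, $i\in\mathcal S\setminus\{k\}$, having exactly $TQ\,r^{\mathcal S\setminus\{i\}}_{k,\mathcal S}(\mathcal D)$ bits. The set $\mathcal R^{\mathcal S\setminus\{i\}}_{k,\mathcal S}(\mathcal D)$ is passed on to be handled when the subset $\mathcal S\setminus\{i\}$ is processed. 3. Each worker $j\in\mathcal S$ multicasts to all workers in $\mathcal S\setminus\{j\}$ the bitwise XOR $$C^{\mathcal D}_{\mathcal S|j}=\bigoplus_{k\in\mathcal S\setminus\{j\}}\mathcal I^{\mathcal D}_{k,\mathcal S|j},$$ each $\mathcal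 I^{\mathcal D}_{k,\mathcal S|j}$ being read as a bit string in an agreed order. **Validity.** A scheme is valid if in the shuffling phase all workers can obtain the IVs they need to compute their assigned target functions. *)

theory Defs
  imports Complex_Main "HOL-Library.Z2" "HOL-Library.Disjoint_Sets"
begin

text \<open>
  Workers are \<open>{1..K}\<close>, files \<open>{1..N}\<close>, target functions \<open>{1..Q}\<close>; \<open>W k\<close> is the set of
  target functions assigned to worker \<open>k\<close>. The triple \<open>(q, n, b)\<close> names bit number \<open>b < T\<close> of the
  intermediate value (IV) \<open>V q n\<close>. Bits take values in the field \<open>bit\<close> of two elements, whose
  addition is XOR.
\<close>

type_synonym iv_bit = "nat \<times> nat \<times> nat"
type_synonym iv_values = "nat \<Rightarrow> nat \<Rightarrow> bit list"

definition file_placement :: "nat \<Rightarrow> nat \<Rightarrow> (nat \<Rightarrow> nat) \<Rightarrow> (nat \<Rightarrow> nat set \<Rightarrow> nat) \<Rightarrow> bool" where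
  "file_placement K N M t \<longleftrightarrow>
     (\<forall>n\<in>{1..N}. \<forall>S. S \<noteq> {} \<and> S \<subseteq> {1..K} \<longrightarrow> t n S \<in> {0, 1}) \<and>
     (\<forall>n\<in>{1..N}. (\<Sum>S\<in>{S. S \<noteq> {} \<and> S \<subseteq> {1..K}}. t n S) = 1) \<and>
     (\<forall>k\<in>{1..K}. (\<Sum>n=1..N. \<Sum>S\<in>{S. S \<subseteq> {1..K} \<and> k \<in> S}. t n S) \<le> M k)"

definition stored_files :: "nat \<Rightarrow> nat \<Rightarrow> (nat \<Rightarrow> nat set \<Rightarrow> nat) \<Rightarrow> nat \<Rightarrow> nat set" where
  "stored_files K N t k = {n \<in> {1..N}. \<exists>S. S \<subseteq> {1..K} \<and> k \<in> S \<and> t n S = 1}"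

definition files_exactly_at :: "(nat \<Rightarrow> nat set \<Rightarrow> nat) \<Rightarrow> nat set \<Rightarrow> nat set \<Rightarrow> nat set" where
  "files_exactly_at t D S = {n \<in> D. t n S = 1}"

definition iv_bits :: "nat \<Rightarrow> nat set \<Rightarrow> nat set \<Rightarrow> iv_bit set" where
  "iv_bits T A B = {(q, n, b). q \<in> A \<and> n \<in> B \<and> b < T}"

definition local_bits ::
  "nat \<Rightarrow> nat \<Rightarrow> nat \<Rightarrow> nat \<Rightarrow> (nat \<Rightarrow> nat set \<Rightarrow> nat) \<Rightarrow> nat set \<Rightarrow> nat \<Rightarrow> iv_bit set" where
  "local_bits K N Q T t D j = iv_bits T {1..Q} (D \<inter> stored_files K N t j)"

definition shuffle_sets :: "nat \<Rightarrow> nat set set" where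
  "shuffle_sets K = {S. S \<subseteq> {1..K} \<and> card S \<ge> 2}"

definition reducing_load :: "nat \<Rightarrow> (nat \<Rightarrow> nat set) \<Rightarrow> nat \<Rightarrow> real" where
  "reducing_load Q W k = real (card (W k)) / real Q"

text \<open>
  \<open>L j S\<close> is $L_{j,S}$ and \<open>r k S U\<close> is $r^{U}_{k,S}$; the latter is only meaningful for
  \<open>U = S - {i}\<close> with \<open>i \<in> S - {k}\<close>. The convention that there are no residuals when
  \<open>card S = 2\<close> is part of the first definition.
\<close>

definition shuffling_parameters ::
  "nat \<Rightarrow> nat \<Rightarrow> nat \<Rightarrow> (nat \<Rightarrow> nat set \<Rightarrow> real) \<Rightarrow> (nat \<Rightarrow> nat set \<Rightarrow> nat set \<Rightarrow> real) \<Rightarrow> bool" where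
  "shuffling_parameters K Q T L r \<longleftrightarrow>
     (\<forall>S\<in>shuffle_sets K. \<forall>j\<in>S. L j S \<ge> 0 \<and> real T * real Q * L j S \<in> \<int>) \<and>
     (\<forall>S\<in>shuffle_sets K. \<forall>k\<in>S. \<forall>i\<in>S - {k}.
        r k S (S - {i}) \<ge> 0 \<and> real T * real Q * r k S (S - {i}) \<in> \<int> \<and>
        (card S = 2 \<longrightarrow> r k S (S - {i}) = 0))"

definition feasible ::
  "nat \<Rightarrow> nat \<Rightarrow> nat \<Rightarrow> (nat \<Rightarrow> nat set) \<Rightarrow> (nat \<Rightarrow> nat set \<Rightarrow> nat) \<Rightarrow> nat set \<Rightarrow>
   (nat \<Rightarrow> nat set \<Rightarrow> real) \<Rightarrow> (nat \<Rightarrow> nat set \<Rightarrow> nat set \<Rightarrow> real) \<Rightarrow> bool" where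
  "feasible K Q T W t D L r \<longleftrightarrow>
     shuffling_parameters K Q T L r \<and>
     (\<forall>S\<in>shuffle_sets K. \<forall>k\<in>S.
        reducing_load Q W k * (\<Sum>n\<in>D. real (t n (S - {k})))
          + (\<Sum>i\<in>{1..K} - S. r k (S \<union> {i}) S)
        = (\<Sum>j\<in>S - {k}. L j S) + (\<Sum>i\<in>S - {k}. r k S (S - {i})))"

text \<open>
  A state of the procedure consists of the collection of subsets processed so far, the sets
  \<open>P S k j\<close> standing for $I_{k,S|j}$, and the residual sets \<open>R S k U\<close> standing for $R^{U}_{k,S}$.
\<close>

type_synonym nested_state =
  "nat set set \<times> (nat set \<Rightarrow> nat \<Rightarrow> nat \<Rightarrow> iv_bit set) \<times> (nat set \<Rightarrow> nat \<Rightarrow> nat set \<Rightarrow> iv_bit set)"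

definition bits_to_deliver ::
  "nat \<Rightarrow> nat \<Rightarrow> (nat \<Rightarrow> nat set) \<Rightarrow> (nat \<Rightarrow> nat set \<Rightarrow> nat) \<Rightarrow> nat set \<Rightarrow>
   (nat set \<Rightarrow> nat \<Rightarrow> nat set \<Rightarrow> iv_bit set) \<Rightarrow> nat \<Rightarrow> nat set \<Rightarrow> iv_bit set" where
  "bits_to_deliver K T W t D R k S =
     iv_bits T (W k) (files_exactly_at t D (S - {k})) \<union> (\<Union>i\<in>{1..K} - S. R (S \<union> {i}) k S)"

text \<open>
  \<open>X k\<close> is the set to be split for worker \<open>k\<close>, \<open>p k j\<close> and \<open>\<rho> k (S - {i})\<close> are its parts.
\<close>

definition valid_split ::
  "nat \<Rightarrow> nat \<Rightarrow> nat \<Rightarrow> nat \<Rightarrow> (nat \<Rightarrow> nat set \<Rightarrow> nat) \<Rightarrow> nat set \<Rightarrow>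
   (nat \<Rightarrow> nat set \<Rightarrow> real) \<Rightarrow> (nat \<Rightarrow> nat set \<Rightarrow> nat set \<Rightarrow> real) \<Rightarrow> nat set \<Rightarrow>
   (nat \<Rightarrow> iv_bit set) \<Rightarrow> (nat \<Rightarrow> nat \<Rightarrow> iv_bit set) \<Rightarrow> (nat \<Rightarrow> nat set \<Rightarrow> iv_bit set) \<Rightarrow> bool" where
  "valid_split K N Q T t D L r S X p \<rho> \<longleftrightarrow>
     (\<forall>k\<in>S.
        X k = (\<Union>j\<in>S - {k}. p k j) \<union> (\<Union>i\<in>S - {k}. \<rho> k (S - {i})) \<and>
        disjoint_family_on (p k) (S - {k}) \<and>
        disjoint_family_on (\<lambda>i. \<rho> k (S - {i})) (S - {k}) \<and>
        (\<Union>j\<in>S - {k}. p k j) \<inter> (\<Union>i\<in>S - {k}. \<rho> k (S - {i})) = {} \<and>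
        (\<forall>j\<in>S - {k}. p k j \<subseteq> local_bits K N Q T t D j) \<and>
        (\<forall>j\<in>S - {k}. real (card (p k j)) = real T * real Q * L j S) \<and>
        (\<forall>i\<in>S - {k}. real (card (\<rho> k (S - {i}))) = real T * real Q * r k S (S - {i})))"

inductive nested_step ::
  "nat \<Rightarrow> nat \<Rightarrow> nat \<Rightarrow> nat \<Rightarrow> (nat \<Rightarrow> nat set) \<Rightarrow> (nat \<Rightarrow> nat set \<Rightarrow> nat) \<Rightarrow> nat set \<Rightarrow>
   (nat \<Rightarrow> nat set \<Rightarrow> real) \<Rightarrow> (nat \<Rightarrow> nat set \<Rightarrow> nat set \<Rightarrow> real) \<Rightarrow>
   nested_state \<Rightarrow> nested_state \<Rightarrow> bool"
  for K N Q T W t D L r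
  where
  process_subset: "\<lbrakk>S \<in> shuffle_sets K; S \<notin> done;
    \<forall>S'\<in>shuffle_sets K. card S < card S' \<longrightarrow> S' \<in> done;
    valid_split K N Q T t D L r S (\<lambda>k. bits_to_deliver K T W t D R k S) p \<rho>\<rbrakk>
    \<Longrightarrow> nested_step K N Q T W t D L r (done, P, R) (insert S done, P(S := p), R(S := \<rho>))"

definition initial_state :: nested_state where
  "initial_state = ({}, (\<lambda>_ _ _. {}), (\<lambda>_ _ _. {}))"

text \<open>A partial execution, with arbitrary choices in all splits made so far.\<close>

definition reachable ::
  "nat \<Rightarrow> nat \<Rightarrow> nat \<Rightarrow> nat \<Rightarrow> (nat \<Rightarrow> nat set) \<Rightarrow> (nat \<Rightarrow> nat set \<Rightarrow> nat) \<Rightarrow> nat set \<Rightarrow>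
   (nat \<Rightarrow> nat set \<Rightarrow> real) \<Rightarrow> (nat \<Rightarrow> nat set \<Rightarrow> nat set \<Rightarrow> real) \<Rightarrow> nested_state \<Rightarrow> bool" where
  "reachable K N Q T W t D L r s \<longleftrightarrow> (nested_step K N Q T W t D L r)\<^sup>*\<^sup>* initial_state s"

definition can_be_carried_out ::
  "nat \<Rightarrow> nat \<Rightarrow> nat \<Rightarrow> nat \<Rightarrow> (nat \<Rightarrow> nat set) \<Rightarrow> (nat \<Rightarrow> nat set \<Rightarrow> nat) \<Rightarrow> nat set \<Rightarrow>
   (nat \<Rightarrow> nat set \<Rightarrow> real) \<Rightarrow> (nat \<Rightarrow> nat set \<Rightarrow> nat set \<Rightarrow> real) \<Rightarrow> bool" where
  "can_be_carried_out K N Q T W t D L r \<longleftrightarrow>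
     (\<forall>s. reachable K N Q T W t D L r s \<longrightarrow>
        (\<exists>P R. (nested_step K N Q T W t D L r)\<^sup>*\<^sup>* s (shuffle_sets K, P, R)))"

definition agreed_order ::
  "nat \<Rightarrow> (nat set \<Rightarrow> nat \<Rightarrow> nat \<Rightarrow> iv_bit set) \<Rightarrow> (nat set \<Rightarrow> nat \<Rightarrow> nat \<Rightarrow> iv_bit list) \<Rightarrow> bool" where
  "agreed_order K P B \<longleftrightarrow>
     (\<forall>S\<in>shuffle_sets K. \<forall>k\<in>S. \<forall>j\<in>S - {k}. distinct (B S k j) \<and> set (B S k j) = P S k j)"

definition iv_assignment :: "nat \<Rightarrow> nat \<Rightarrow> nat set \<Rightarrow> iv_values \<Rightarrow> bool" where
  "iv_assignment Q T D V \<longleftrightarrow> (\<forall>q\<in>{1..Q}. \<forall>n\<in>D. length (V q n) = T)"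

definition bit_value :: "iv_values \<Rightarrow> iv_bit \<Rightarrow> bit" where
  "bit_value V = (\<lambda>(q, n, b). V q n ! b)"

text \<open>
  The message $C_{S|j}$. All strings \<open>B S k j\<close> with \<open>k \<in> S - {j}\<close> have length $TQ\,L_{j,S}$,
  a natural number.
\<close>

definition coded_message ::
  "nat \<Rightarrow> nat \<Rightarrow> (nat \<Rightarrow> nat set \<Rightarrow> real) \<Rightarrow> (nat set \<Rightarrow> nat \<Rightarrow> nat \<Rightarrow> iv_bit list) \<Rightarrow>
   iv_values \<Rightarrow> nat set \<Rightarrow> nat \<Rightarrow> bit list" where
  "coded_message Q T L B V S j =
     map (\<lambda>m. \<Sum>k\<in>S - {j}. map (bit_value V) (B S k j) ! m) [0..<nat \<lfloor>real T * real Q * L j S\<rfloor>]"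

definition computed_ivs ::
  "nat \<Rightarrow> nat \<Rightarrow> nat \<Rightarrow> (nat \<Rightarrow> nat set \<Rightarrow> nat) \<Rightarrow> nat set \<Rightarrow> nat \<Rightarrow>
   iv_values \<Rightarrow> nat \<Rightarrow> nat \<Rightarrow> bit list option" where
  "computed_ivs K N Q t D k V =
     (\<lambda>q n. if q \<in> {1..Q} \<and> n \<in> D \<inter> stored_files K N t k then Some (V q n) else None)"

definition received_messages ::
  "nat \<Rightarrow> nat \<Rightarrow> nat \<Rightarrow> (nat \<Rightarrow> nat set \<Rightarrow> real) \<Rightarrow> (nat set \<Rightarrow> nat \<Rightarrow> nat \<Rightarrow> iv_bit list) \<Rightarrow>
   nat \<Rightarrow> iv_values \<Rightarrow> nat set \<Rightarrow> nat \<Rightarrow> bit list option" where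
  "received_messages K Q T L B k V =
     (\<lambda>S j. if S \<in> shuffle_sets K \<and> j \<in> S \<and> k \<in> S - {j}
            then Some (coded_message Q T L B V S j) else None)"

text \<open>
  The encoder and the decoder below may depend on the placement, the parameters, the splits and the
  bit orders, which are common knowledge, but not on the values \<open>V\<close> of the IVs.
\<close>

definition can_encode ::
  "nat \<Rightarrow> nat \<Rightarrow> nat \<Rightarrow> nat \<Rightarrow> (nat \<Rightarrow> nat set \<Rightarrow> nat) \<Rightarrow> nat set \<Rightarrow> (nat \<Rightarrow> nat set \<Rightarrow> real) \<Rightarrow>
   (nat set \<Rightarrow> nat \<Rightarrow> nat \<Rightarrow> iv_bit list) \<Rightarrow> nat set \<Rightarrow> nat \<Rightarrow> bool" where
  "can_encode K N Q T t D L B S j \<longleftrightarrow>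
     (\<exists>enc. \<forall>V. iv_assignment Q T D V \<longrightarrow>
        enc (computed_ivs K N Q t D j V) = coded_message Q T L B V S j)"

definition can_recover ::
  "nat \<Rightarrow> nat \<Rightarrow> nat \<Rightarrow> nat \<Rightarrow> (nat \<Rightarrow> nat set) \<Rightarrow> (nat \<Rightarrow> nat set \<Rightarrow> nat) \<Rightarrow> nat set \<Rightarrow>
   (nat \<Rightarrow> nat set \<Rightarrow> real) \<Rightarrow> (nat set \<Rightarrow> nat \<Rightarrow> nat \<Rightarrow> iv_bit list) \<Rightarrow> nat \<Rightarrow> bool" where
  "can_recover K N Q T W t D L B k \<longleftrightarrow>
     (\<exists>dec. \<forall>V. iv_assignment Q T D V \<longrightarrow>
        (\<forall>q\<in>W k. \<forall>n\<in>D - stored_files K N t k.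
           dec (computed_ivs K N Q t D k V) (received_messages K Q T L B k V) q n = V q n))"

end

theory Submission
  imports Defs
begin

text \<open>
  A bit held exactly by the set \<open>A\<close> of workers and needed by \<open>k\<close> enters the procedure at
  \<open>A \<union> {k}\<close> and then only moves to smaller sets containing \<open>k\<close>. Hence every bit waiting for \<open>k\<close> at
  \<open>S\<close> is known to all of \<open>S - {k}\<close>, so any split with the right sizes is admissible and all
  interference in the messages is known to the receiver. At each level a bit sits in only one set,
  so feasibility is exactly the count that makes such a split exist.
\<close>

section \<open>Tools: functions of an observation, and partitions with prescribed sizes\<close>

text \<open>Evaluating \<open>h\<close> at any chosen \<open>V'\<close> with \<open>A V'\<close> and
  the observed value of \<open>g\<close> gives the right result. This reduces the existence of an
  encoder or decoder to comparing two IV assignments with the same view.\<close>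

lemma factors_through:
  assumes "\<And>V V'. A V \<Longrightarrow> A V' \<Longrightarrow> g V = g V' \<Longrightarrow> h V = h V'"
  shows "\<exists>f. \<forall>V. A V \<longrightarrow> f (g V) = h V"
proof (intro exI allI impI)
  fix V assume "A V"
  then have "A (SOME V'. A V' \<and> g V' = g V) \<and> g (SOME V'. A V' \<and> g V' = g V) = g V"
    by (metis (mono_tags, lifting) someI_ex)
  then show "(\<lambda>c. h (SOME V'. A V' \<and> g V' = c)) (g V) = h V"
    using assms \<open>A V\<close> by blast
qed

text \<open>Greedy: cut off a piece of size \<open>c a\<close> and partition the rest by induction.
  Parts may be empty.\<close>

lemma partition_with_cards:
  assumes "finite I" "finite X" "card X = (\<Sum>i\<in>I. c i)"
  shows "\<exists>f. (\<forall>i\<in>I. card (f i) = c i) \<and> disjoint_family_on f I \<and> (\<Union>i\<in>I. f i) = X"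
  using assms
proof (induction I arbitrary: X rule: finite_induct)
  case empty
  then show ?case by (simp add: disjoint_family_on_def)
next
  case (insert a I)
  have cards: "card X = c a + (\<Sum>i\<in>I. c i)"
    using insert.prems(2) insert.hyps by simp
  then have "c a \<le> card X" by simp
  then obtain Y where Y: "Y \<subseteq> X" "card Y = c a"
    by (rule obtain_subset_with_card_n)
  have "card (X - Y) = (\<Sum>i\<in>I. c i)"
    using Y cards card_Diff_subset[OF finite_subset[OF Y(1) insert.prems(1)] Y(1)] by simp
  then obtain f where f: "\<forall>i\<in>I. card (f i) = c i" "disjoint_family_on f I" "(\<Union>i\<in>I. f i) = X - Y"
    using insert.IH[of "X - Y"] insert.prems(1) by auto
  have eq: "(f(a := Y)) i = f i" if "i \<in> I" for i
    using that insert.hyps by auto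
  have "disjoint_family_on (f(a := Y)) (insert a I)"
    using f(2,3) insert.hyps eq by (auto simp: disjoint_family_on_insert disjoint_family_on_def)
  moreover have "(\<Union>i\<in>insert a I. (f(a := Y)) i) = X"
  proof -
    have "(\<Union>i\<in>I. (f(a := Y)) i) = X - Y" using f(3) eq by (metis SUP_cong)
    then show ?thesis using Y(1) unfolding UN_insert fun_upd_same by blast
  qed
  moreover have "\<forall>i\<in>insert a I. card ((f(a := Y)) i) = c i"
    using f(1) Y eq by auto
  ultimately show ?case by blast
qed

section \<open>Subsets of workers and the parts of a valid split\<close>

lemma inj_on_remove: "inj_on (\<lambda>i. S - {i}) (S - A)"
  by (rule inj_onI) blast

lemma finite_shuffle_sets: "finite (shuffle_sets K)"
  by (simp add: shuffle_sets_def)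

lemma shuffle_setsD:
  assumes "S \<in> shuffle_sets K"
  shows "S \<subseteq> {1..K}" "finite S" "card S \<ge> 2"
  using assms finite_subset by (auto simp: shuffle_sets_def)

lemma insert_shuffle_sets:
  assumes "S \<in> shuffle_sets K" "i \<in> {1..K} - S"
  shows "insert i S \<in> shuffle_sets K" "card (insert i S) = Suc (card S)"
  using assms shuffle_setsD[OF assms(1)] by (auto simp: shuffle_sets_def)

lemma remove_nonempty:
  assumes "S \<in> shuffle_sets K"
  shows "S - {k} \<noteq> {}"
proof
  assume "S - {k} = {}"
  then have "S \<subseteq> {k}" by blast
  then have "card S \<le> 1" using card_mono[of "{k}" S] by simp
  then show False using shuffle_setsD(3)[OF assms] by simp
qed

lemma valid_splitD:
  assumes "valid_split K N Q T t D L r S X p \<rho>" "k \<in> S"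
  shows "X k = (\<Union>j\<in>S - {k}. p k j) \<union> (\<Union>i\<in>S - {k}. \<rho> k (S - {i}))"
    and "disjoint_family_on (\<lambda>i. \<rho> k (S - {i})) (S - {k})"
    and "\<And>j. j \<in> S - {k} \<Longrightarrow> p k j \<subseteq> X k"
    and "\<And>j. j \<in> S - {k} \<Longrightarrow> p k j \<subseteq> local_bits K N Q T t D j"
    and "\<And>j. j \<in> S - {k} \<Longrightarrow> real (card (p k j)) = real T * real Q * L j S"
    and "\<And>i. i \<in> S - {k} \<Longrightarrow> real (card (\<rho> k (S - {i}))) = real T * real Q * r k S (S - {i})"
proof -
  note split = bspec[OF assms(1)[unfolded valid_split_def] assms(2)]
  show "X k = (\<Union>j\<in>S - {k}. p k j) \<union> (\<Union>i\<in>S - {k}. \<rho> k (S - {i}))"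
    "disjoint_family_on (\<lambda>i. \<rho> k (S - {i})) (S - {k})"
    using split by blast+
  then show "\<And>j. j \<in> S - {k} \<Longrightarrow> p k j \<subseteq> X k" by auto
  show "\<And>j. j \<in> S - {k} \<Longrightarrow> p k j \<subseteq> local_bits K N Q T t D j"
    "\<And>j. j \<in> S - {k} \<Longrightarrow> real (card (p k j)) = real T * real Q * L j S"
    "\<And>i. i \<in> S - {k} \<Longrightarrow> real (card (\<rho> k (S - {i}))) = real T * real Q * r k S (S - {i})"
    using split by simp_all
qed

text \<open>A split indexes its residuals by the set it processes minus one worker; this is the same
  information seen from the receiving set \<open>S\<close>, with \<open>insert i S\<close> as its
  parent.\<close>

lemma valid_split_residual:
  assumes "valid_split K N Q T t D L r (insert i S) X p \<rho>" "k \<in> S" "i \<notin> S"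
  shows "\<rho> k S \<subseteq> X k"
    and "real (card (\<rho> k S)) = real T * real Q * r k (insert i S) S"
proof -
  have "insert i S - {i} = S" "i \<in> insert i S - {k}" "k \<in> insert i S"
    using assms by auto
  then show "\<rho> k S \<subseteq> X k" "real (card (\<rho> k S)) = real T * real Q * r k (insert i S) S"
    using valid_splitD(1)[OF assms(1), of k] valid_splitD(6)[OF assms(1), of k i] by auto
qed

section \<open>The placement in terms of holder sets\<close>

locale nested_shuffling =
  fixes K N Q T :: nat
    and M :: "nat \<Rightarrow> nat"
    and W :: "nat \<Rightarrow> nat set"
    and t :: "nat \<Rightarrow> nat set \<Rightarrow> nat"
    and D :: "nat set"
  assumes Q_pos: "Q \<ge> 1"
    and W_Union: "(\<Union>k\<in>{1..K}. W k) = {1..Q}"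
    and placement: "file_placement K N M t"
    and D_subset: "D \<subseteq> {1..N}"
begin

lemma finite_D: "finite D"
  using D_subset finite_subset by blast

lemma W_subset: "k \<in> {1..K} \<Longrightarrow> W k \<subseteq> {1..Q}"
  using W_Union by blast

text \<open>Well defined for files in \<open>D\<close>, since the placement constraint leaves
  exactly one nonempty \<open>S\<close> with \<open>t n S = 1\<close>.\<close>

definition holders :: "nat \<Rightarrow> nat set" where
  "holders n = (THE S. S \<noteq> {} \<and> S \<subseteq> {1..K} \<and> t n S = 1)"

text \<open>Natural numbers with sum 1 consist of a single 1 and otherwise zeros.\<close>

lemma
  assumes "n \<in> D"
  shows holders_nonempty: "holders n \<noteq> {}"
    and holders_subset: "holders n \<subseteq> {1..K}"
    and placement_eq: "\<And>S. S \<noteq> {} \<Longrightarrow> S \<subseteq> {1..K} \<Longrightarrow> t n S = (if S = holders n then 1 else 0)"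
proof -
  let ?F = "{S. S \<noteq> {} \<and> S \<subseteq> {1..K}}"
  have fin: "finite ?F" by simp
  have n: "n \<in> {1..N}" using assms D_subset by blast
  have sum: "(\<Sum>S\<in>?F. t n S) = 1"
    using placement n unfolding file_placement_def by blast
  obtain A where A: "A \<in> ?F" "t n A = 1" and unique: "\<And>S. S \<in> ?F \<Longrightarrow> S \<noteq> A \<Longrightarrow> t n S = 0"
    using iffD1[OF sum_eq_1_iff[OF fin] sum] by (metis (lifting))
  have "holders n = A"
    unfolding holders_def
  proof (rule the_equality)
    show "A \<noteq> {} \<and> A \<subseteq> {1..K} \<and> t n A = 1" using A by blast
    show "S = A" if "S \<noteq> {} \<and> S \<subseteq> {1..K} \<and> t n S = 1" for S
      using unique[of S] that by fastforce
  qed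
  then show "holders n \<noteq> {}" "holders n \<subseteq> {1..K}"
    "\<And>S. S \<noteq> {} \<Longrightarrow> S \<subseteq> {1..K} \<Longrightarrow> t n S = (if S = holders n then 1 else 0)"
    using A unique by auto
qed

lemma stored_iff_holders:
  assumes "n \<in> D"
  shows "n \<in> stored_files K N t k \<longleftrightarrow> k \<in> holders n"
proof
  assume "n \<in> stored_files K N t k"
  then obtain S where "S \<subseteq> {1..K}" "k \<in> S" "t n S = 1"
    by (auto simp: stored_files_def)
  then show "k \<in> holders n"
    using placement_eq[OF assms, of S] by (cases "S = holders n") auto
next
  assume "k \<in> holders n"
  moreover have "t n (holders n) = 1"
    using placement_eq[OF assms holders_nonempty[OF assms] holders_subset[OF assms]] by simp
  ultimately show "n \<in> stored_files K N t k"
    using holders_subset[OF assms] assms D_subset unfolding stored_files_def by blast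
qed

lemma files_exactly_at_eq:
  assumes "S \<noteq> {}" "S \<subseteq> {1..K}"
  shows "files_exactly_at t D S = {n \<in> D. holders n = S}"
  unfolding files_exactly_at_def using placement_eq[OF _ assms]
  by (metis (lifting) zero_neq_one)

text \<open>Turns the demand term of the feasibility constraint into a number of files.\<close>

lemma card_files_exactly_at:
  assumes "S \<noteq> {}" "S \<subseteq> {1..K}"
  shows "(\<Sum>n\<in>D. real (t n S)) = real (card (files_exactly_at t D S))"
proof -
  have "(\<Sum>n\<in>D. real (t n S)) = (\<Sum>n\<in>D. if holders n = S then 1 else 0)"
    by (rule sum.cong) (use placement_eq assms in auto)
  also have "\<dots> = real (card {n \<in> D. holders n = S})"
    using finite_D by (simp add: sum.If_cases Int_def)
  finally show ?thesis using files_exactly_at_eq assms by simp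
qed

lemma iv_bits_Times: "iv_bits T A B = A \<times> B \<times> {..<T}"
  by (auto simp: iv_bits_def)

lemma local_bits_iff:
  "(q, n, b) \<in> local_bits K N Q T t D j \<longleftrightarrow> q \<in> {1..Q} \<and> n \<in> D \<and> j \<in> holders n \<and> b < T"
  using stored_iff_holders by (auto simp: local_bits_def iv_bits_def)

abbreviation deliver ::
  "(nat set \<Rightarrow> nat \<Rightarrow> nat set \<Rightarrow> iv_bit set) \<Rightarrow> nat \<Rightarrow> nat set \<Rightarrow> iv_bit set" where
  "deliver \<equiv> bits_to_deliver K T W t D"

lemma deliver_iff:
  assumes "S \<in> shuffle_sets K"
  shows "(q, n, b) \<in> deliver R k S \<longleftrightarrow>
    q \<in> W k \<and> n \<in> D \<and> holders n = S - {k} \<and> b < T \<or>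
    (\<exists>i\<in>{1..K} - S. (q, n, b) \<in> R (insert i S) k S)"
proof -
  have "files_exactly_at t D (S - {k}) = {n \<in> D. holders n = S - {k}}"
    using files_exactly_at_eq[OF remove_nonempty[OF assms], of k] shuffle_setsD(1)[OF assms] by auto
  then show ?thesis by (auto simp: bits_to_deliver_def iv_bits_def)
qed

end

section \<open>The invariant of executions with fixed feasible parameters\<close>

locale parametrized_shuffling = nested_shuffling +
  fixes L :: "nat \<Rightarrow> nat set \<Rightarrow> real"
    and r :: "nat \<Rightarrow> nat set \<Rightarrow> nat set \<Rightarrow> real"
  assumes feasible: "feasible K Q T W t D L r"
begin

text \<open>The prescribed sizes are nonnegative integers; as naturals they can be fed to
  \<open>partition_with_cards\<close>.\<close>

lemma size_nat:
  assumes "S \<in> shuffle_sets K"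
  shows "j \<in> S \<Longrightarrow> \<exists>m. real T * real Q * L j S = real m"
    and "k \<in> S \<Longrightarrow> i \<in> S - {k} \<Longrightarrow> \<exists>m. real T * real Q * r k S (S - {i}) = real m"
proof -
  have *: "\<exists>m. x = real m" if "x \<in> \<int>" "0 \<le> x" for x :: real
    using that by (metis Nats_cases Nats_altdef2 mem_Collect_eq)
  show "\<exists>m. real T * real Q * L j S = real m" if "j \<in> S"
    by (rule *) (use feasible that assms in \<open>auto simp: feasible_def shuffling_parameters_def\<close>)
  show "\<exists>m. real T * real Q * r k S (S - {i}) = real m" if "k \<in> S" "i \<in> S - {k}"
    by (rule *) (use feasible that assms in \<open>auto simp: feasible_def shuffling_parameters_def\<close>)
qed

lemma no_residual:
  "S \<in> shuffle_sets K \<Longrightarrow> card S = 2 \<Longrightarrow> k \<in> S \<Longrightarrow> i \<in> S - {k} \<Longrightarrow> r k S (S - {i}) = 0"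
  using feasible by (auto simp: feasible_def shuffling_parameters_def)

text \<open>All sets that can pass residuals down to \<open>S\<close> are processed, so
  \<open>deliver R k S\<close> is final. Whether \<open>S\<close> itself is in \<open>done\<close>
  is left open, so the notion covers both processed sets and the next candidate.\<close>

definition ready :: "nat set set \<Rightarrow> nat set \<Rightarrow> bool" where
  "ready done S \<longleftrightarrow> S \<in> shuffle_sets K \<and> (\<forall>S'\<in>shuffle_sets K. card S < card S' \<longrightarrow> S' \<in> done)"

text \<open>Each split is required to be valid for the current \<open>R\<close>, not for the one at
  the time of processing; \<open>consistent_step\<close> shows that the two agree where it
  matters.\<close>

definition consistent :: "nested_state \<Rightarrow> bool" where
  "consistent = (\<lambda>(done, P, R). \<forall>S\<in>done. ready done S \<and>
     valid_split K N Q T t D L r S (\<lambda>k. deliver R k S) (P S) (R S))"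

lemma consistentD:
  assumes "consistent (done, P, R)" "S \<in> done"
  shows "ready done S" "valid_split K N Q T t D L r S (\<lambda>k. deliver R k S) (P S) (R S)"
  using assms unfolding consistent_def by blast+

lemma ready_insert:
  assumes "ready done S" "i \<in> {1..K} - S"
  shows "insert i S \<in> done"
  using assms insert_shuffle_sets[of S K i] unfolding ready_def by auto

text \<open>Induction along the processing order, downwards from the set of all workers, with
  \<open>K - card S\<close> as measure.\<close>

lemma ready_induct [consumes 1, case_names step]:
  assumes "ready done S"
    and step: "\<And>S. ready done S \<Longrightarrow> (\<And>i. i \<in> {1..K} - S \<Longrightarrow> ready done (insert i S) \<Longrightarrow> Pr (insert i S)) \<Longrightarrow> Pr S"
  shows "Pr S"
  using assms(1)
proof (induction "K - card S" arbitrary: S rule: less_induct)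
  case less
  show ?case
  proof (rule step[OF less.prems])
    fix i assume i: "i \<in> {1..K} - S" "ready done (insert i S)"
    have S: "S \<in> shuffle_sets K" using less.prems ready_def by blast
    have "card (insert i S) \<le> K"
      using card_mono[of "{1..K}" "insert i S"] shuffle_setsD[OF S] i by simp
    then have "K - card (insert i S) < K - card S"
      using insert_shuffle_sets(2)[OF S i(1)] by simp
    then show "Pr (insert i S)" using less.hyps i(2) by blast
  qed
qed

lemma residual_subset:
  assumes "consistent (done, P, R)" "ready done S" "i \<in> {1..K} - S" "k \<in> S"
  shows "R (insert i S) k S \<subseteq> deliver R k (insert i S)"
    and "real (card (R (insert i S) k S)) = real T * real Q * r k (insert i S) S"
  using valid_split_residual[OF consistentD(2)[OF assms(1) ready_insert[OF assms(2,3)]]] assms by auto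

text \<open>A fresh bit at \<open>S\<close> has holder set exactly \<open>S - {k}\<close>. A
  residual bit comes from some \<open>insert i S\<close>, where by induction its holders contain the
  even larger set \<open>insert i S - {k}\<close>.\<close>

lemma deliver_holders:
  assumes "ready done S" "consistent (done, P, R)" "k \<in> S" "(q, n, b) \<in> deliver R k S"
  shows "q \<in> W k \<and> n \<in> D \<and> b < T \<and> S - {k} \<subseteq> holders n \<and> k \<notin> holders n"
  using assms
proof (induction rule: ready_induct)
  case (step S)
  have S: "S \<in> shuffle_sets K" using step.hyps ready_def by blast
  consider "q \<in> W k" "n \<in> D" "holders n = S - {k}" "b < T"
    | i where "i \<in> {1..K} - S" "(q, n, b) \<in> R (insert i S) k S"
    using step.prems(3) deliver_iff[OF S] by blast
  then show ?case
  proof cases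
    case 2
    have "insert i S \<in> done" using ready_insert step.hyps 2(1) by blast
    then have rdy: "ready done (insert i S)" using consistentD step.prems(1) by blast
    have "(q, n, b) \<in> deliver R k (insert i S)"
      using residual_subset(1)[OF step.prems(1) step.hyps 2(1) step.prems(2)] 2(2) by blast
    then have "q \<in> W k \<and> n \<in> D \<and> b < T \<and> insert i S - {k} \<subseteq> holders n \<and> k \<notin> holders n"
      using step.IH[OF 2(1) rdy step.prems(1)] step.prems(2) by blast
    then show ?thesis by blast
  qed auto
qed

text \<open>The worker \<open>i\<close> dropped from the parent also holds the bit, so a residual
  bit is never fresh at \<open>S\<close>.\<close>

lemma residual_holders:
  assumes "consistent (done, P, R)" "ready done S" "i \<in> {1..K} - S" "k \<in> S" "(q, n, b) \<in> R (insert i S) k S"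
  shows "holders n \<noteq> S - {k}"
proof -
  have "ready done (insert i S)"
    using ready_insert[OF assms(2,3)] consistentD(1)[OF assms(1)] by blast
  then have "insert i S - {k} \<subseteq> holders n"
    using deliver_holders[of "done" "insert i S" P R k q n b] residual_subset(1)[OF assms(1-4)] assms by blast
  then show ?thesis using assms(3,4) by blast
qed

text \<open>The number of holders tells whether the bit is fresh or residual, alike for
  \<open>S\<close> and \<open>S'\<close>. If fresh, its holder set determines the set. If residual,
  both parents coincide by induction, and a split puts a bit into only one residual set.\<close>

lemma deliver_disjoint:
  assumes "ready done S" "consistent (done, P, R)" "ready done S'" "card S = card S'"
    "k \<in> S" "k \<in> S'" "x \<in> deliver R k S" "x \<in> deliver R k S'"
  shows "S = S'"
  using assms
proof (induction arbitrary: S' rule: ready_induct)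
  case (step S)
  obtain q n b where x: "x = (q, n, b)" by (cases x) auto
  have S: "S \<in> shuffle_sets K" and S': "S' \<in> shuffle_sets K"
    using step.hyps step.prems(2) ready_def by blast+
  have fin: "finite S" "finite S'" using shuffle_setsD S S' by blast+
  \<comment> \<open>A residual bit at \<open>A\<close> has at least \<open>card A\<close> holders, a
    fresh one exactly \<open>card A - 1\<close>; this rules out the mixed cases below.\<close>
  have larger: "card (S - {k}) < card (holders n)"
    if "ready done A" "i \<in> {1..K} - A" "x \<in> R (insert i A) k A" "k \<in> A" "card A = card S" for A i
  proof -
    have A: "A \<in> shuffle_sets K" using that ready_def by blast
    have "ready done (insert i A)"
      using ready_insert[OF that(1,2)] consistentD(1)[OF step.prems(1)] by blast
    then have "insert i A - {k} \<subseteq> holders n" and n: "n \<in> D"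
      using deliver_holders[of "done" "insert i A" P R k q n b]
        residual_subset(1)[OF step.prems(1) that(1,2,4)] that x step.prems(1) by blast+
    moreover have "finite (holders n)" using holders_subset[OF n] finite_subset by blast
    ultimately have "card (insert i A - {k}) \<le> card (holders n)" using card_mono by blast
    then show ?thesis
      using insert_shuffle_sets(2)[OF A that(2)] that shuffle_setsD(2,3)[OF A] step.prems(4) by simp
  qed
  have same: "card (S' - {k}) = card (S - {k})" using step.prems fin by simp
  consider "holders n = S - {k}" "holders n = S' - {k}"
    | i i' where "i \<in> {1..K} - S" "x \<in> R (insert i S) k S"
        "i' \<in> {1..K} - S'" "x \<in> R (insert i' S') k S'"
    using step.prems(6,7) deliver_iff[OF S] deliver_iff[OF S'] x
      larger[OF step.hyps] larger[OF step.prems(2)] step.prems(3-5) same by (metis less_irrefl)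
  then show ?case
  proof cases
    case 1
    then show ?thesis using step.prems(4,5) by blast
  next
    case 2
    have in_done: "insert i S \<in> done" "insert i' S' \<in> done"
      using ready_insert step.hyps step.prems(2) 2 by blast+
    then have rdy: "ready done (insert i S)" "ready done (insert i' S')"
      using consistentD(1) step.prems(1) by blast+
    have eq: "insert i S = insert i' S'"
      using step.IH[OF 2(1) rdy(1) step.prems(1) rdy(2)] insert_shuffle_sets(2)[OF S 2(1)]
        insert_shuffle_sets(2)[OF S' 2(3)] step.prems(3-5)
        residual_subset(1)[OF step.prems(1) step.hyps 2(1) step.prems(4)]
        residual_subset(1)[OF step.prems(1,2) 2(3) step.prems(5)] 2(2,4) by auto
    let ?U = "insert i S"
    have S_eq: "S = ?U - {i}" "S' = ?U - {i'}" using 2 eq by auto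
    have i: "i \<in> ?U - {k}" "i' \<in> ?U - {k}" using 2 eq step.prems(4,5) by auto
    have "disjoint_family_on (\<lambda>i. R ?U k (?U - {i})) (?U - {k})"
      using valid_splitD(2)[OF consistentD(2)[OF step.prems(1) in_done(1)]] step.prems(4) by blast
    \<comment> \<open>The bit lies in two residual sets of the same split, which are disjoint for
      different dropped workers.\<close>
    then have "i = i'"
      using i 2(2,4) S_eq eq unfolding disjoint_family_on_def by (metis IntI emptyE)
    then show ?thesis using S_eq by simp
  qed
qed

section \<open>Counting the waiting bits and splitting them\<close>

lemma finite_deliver:
  assumes "ready done S" "consistent (done, P, R)" "k \<in> S"
  shows "finite (deliver R k S)"
proof (rule finite_subset)
  show "deliver R k S \<subseteq> iv_bits T (W k) D"
    using deliver_holders[OF assms] by (auto simp: iv_bits_def)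
  have "finite (W k)"
    using W_subset[of k] assms shuffle_setsD(1)[of S K] finite_subset[of "W k" "{1..Q}"] ready_def by blast
  then show "finite (iv_bits T (W k) D)"
    using finite_D by (simp add: iv_bits_Times)
qed

text \<open>The union defining \<open>deliver\<close> is disjoint, so its size is
  \<open>T * Q\<close> times the left side of the feasibility constraint; the claim is the right
  side.\<close>

lemma card_deliver:
  assumes "ready done S" "consistent (done, P, R)" "k \<in> S"
  shows "real (card (deliver R k S)) =
    (\<Sum>j\<in>S - {k}. real T * real Q * L j S) + (\<Sum>i\<in>S - {k}. real T * real Q * r k S (S - {i}))"
proof -
  let ?A = "files_exactly_at t D (S - {k})"
  let ?V = "iv_bits T (W k) ?A" and ?R = "\<lambda>i. R (insert i S) k S"
  have S: "S \<in> shuffle_sets K" using assms ready_def by blast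
  have ne: "S - {k} \<noteq> {}" "S - {k} \<subseteq> {1..K}"
    using remove_nonempty[OF S] shuffle_setsD(1)[OF S] by blast+
  have eq: "deliver R k S = ?V \<union> (\<Union>i\<in>{1..K} - S. ?R i)"
    by (simp add: bits_to_deliver_def)
  have fin: "finite ?V" "finite (\<Union>i\<in>{1..K} - S. ?R i)"
    using finite_deliver[OF assms] eq by auto
  have "?V \<inter> (\<Union>i\<in>{1..K} - S. ?R i) = {}"
    using residual_holders[OF assms(2,1) _ assms(3)] files_exactly_at_eq[OF ne]
    by (auto simp: iv_bits_def)
  then have 1: "card (deliver R k S) = card ?V + card (\<Union>i\<in>{1..K} - S. ?R i)"
    using eq fin card_Un_disjoint by metis
  \<comment> \<open>The two parents are distinct sets of equal size, so
    \<open>deliver_disjoint\<close> separates what waits there.\<close>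
  have "?R i \<inter> ?R i' = {}" if i: "i \<in> {1..K} - S" "i' \<in> {1..K} - S" "i \<noteq> i'" for i i'
  proof -
    have "ready done (insert i S)" "ready done (insert i' S)"
      using ready_insert[OF assms(1)] consistentD(1)[OF assms(2)] i by blast+
    moreover have "insert i S \<noteq> insert i' S" using i by blast
    ultimately have "x \<notin> deliver R k (insert i' S)" if "x \<in> deliver R k (insert i S)" for x
      using deliver_disjoint[of "done" "insert i S" P R "insert i' S" k x] assms(2,3)
        insert_shuffle_sets(2)[OF S i(1)] insert_shuffle_sets(2)[OF S i(2)] that by auto
    then show ?thesis
      using residual_subset(1)[OF assms(2,1) i(1) assms(3)] residual_subset(1)[OF assms(2,1) i(2) assms(3)]
      by blast
  qed
  then have 2: "card (\<Union>i\<in>{1..K} - S. ?R i) = (\<Sum>i\<in>{1..K} - S. card (?R i))"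
    using fin(2) by (intro card_UN_disjoint) (auto simp: finite_UN)
  have "card ?V = card (W k) * card ?A * T"
    by (simp add: iv_bits_Times card_cartesian_product)
  \<comment> \<open>The factor \<open>Q\<close> cancels the denominator of
    \<open>reducing_load\<close>, as \<open>Q\<close> is positive.\<close>
  then have "real (card ?V) = real T * real Q * (reducing_load Q W k * (\<Sum>n\<in>D. real (t n (S - {k}))))"
    using card_files_exactly_at[OF ne] Q_pos by (simp add: reducing_load_def)
  then have "real (card (deliver R k S)) = real T * real Q *
     (reducing_load Q W k * (\<Sum>n\<in>D. real (t n (S - {k}))) + (\<Sum>i\<in>{1..K} - S. r k (insert i S) S))"
    using 1 2 residual_subset(2)[OF assms(2,1) _ assms(3)]
    by (simp add: sum_distrib_left distrib_left)
  also have "\<dots> = real T * real Q * ((\<Sum>j\<in>S - {k}. L j S) + (\<Sum>i\<in>S - {k}. r k S (S - {i})))"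
    using feasible S assms(3) by (simp add: feasible_def)
  finally show ?thesis by (simp add: sum_distrib_left distrib_left)
qed

text \<open>Any partition with the prescribed sizes will do: availability at the senders is
  automatic by \<open>deliver_holders\<close>.\<close>

lemma ex_split:
  assumes "ready done S" "consistent (done, P, R)"
  shows "\<exists>p \<rho>. valid_split K N Q T t D L r S (\<lambda>k. deliver R k S) p \<rho>"
proof -
  have S: "S \<in> shuffle_sets K" using assms ready_def by blast
  \<comment> \<open>One index set for all parts: senders \<open>j\<close> on the left, target sets
    of residuals on the right, as a split names residuals by their target set.\<close>
  let ?I = "\<lambda>k. (S - {k}) <+> ((\<lambda>i. S - {i}) ` (S - {k}))"
  obtain l where l: "\<And>j. j \<in> S \<Longrightarrow> real T * real Q * L j S = real (l j)"
    using size_nat(1)[OF S] by metis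
  obtain \<sigma> where \<sigma>: "\<And>k i. k \<in> S \<Longrightarrow> i \<in> S - {k} \<Longrightarrow> real T * real Q * r k S (S - {i}) = real (\<sigma> k i)"
    using size_nat(2)[OF S] by metis
  let ?c = "\<lambda>k. case_sum l (\<lambda>U. nat \<lfloor>real T * real Q * r k S U\<rfloor>)"
  have "\<exists>f. (\<forall>x\<in>?I k. card (f x) = ?c k x) \<and> disjoint_family_on f (?I k) \<and> (\<Union>x\<in>?I k. f x) = deliver R k S"
    if k: "k \<in> S" for k
  proof (rule partition_with_cards)
    have "real (card (deliver R k S)) = (\<Sum>j\<in>S - {k}. real (l j)) + (\<Sum>i\<in>S - {k}. real (\<sigma> k i))"
      using card_deliver[OF assms k] l \<sigma>[OF k] by simp
    then have "card (deliver R k S) = (\<Sum>j\<in>S - {k}. l j) + (\<Sum>i\<in>S - {k}. \<sigma> k i)"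
      by (metis of_nat_add of_nat_eq_iff of_nat_sum)
    also have "(\<Sum>i\<in>S - {k}. \<sigma> k i) = (\<Sum>U\<in>(\<lambda>i. S - {i}) ` (S - {k}). ?c k (Inr U))"
      using \<sigma>[OF k] by (simp add: sum.reindex[OF inj_on_remove])
    finally show "card (deliver R k S) = (\<Sum>x\<in>?I k. ?c k x)"
      using shuffle_setsD(2)[OF S] by (simp add: sum.Plus)
  qed (use shuffle_setsD(2)[OF S] finite_deliver[OF assms k] in auto)
  then obtain f where f: "\<And>k. k \<in> S \<Longrightarrow> (\<forall>x\<in>?I k. card (f k x) = ?c k x) \<and>
      disjoint_family_on (f k) (?I k) \<and> (\<Union>x\<in>?I k. f k x) = deliver R k S"
    by metis
  have "valid_split K N Q T t D L r S (\<lambda>k. deliver R k S) (\<lambda>k j. f k (Inl j)) (\<lambda>k U. f k (Inr U))"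
    unfolding valid_split_def
  proof (intro ballI conjI)
    fix k assume k: "k \<in> S"
    note fk = f[OF k]
    have inl: "Inl j \<in> ?I k" if "j \<in> S - {k}" for j using that by blast
    have inr: "Inr (S - {i}) \<in> ?I k" if "i \<in> S - {k}" for i using that by blast
    have disj: "f k x \<inter> f k y = {}" if "x \<in> ?I k" "y \<in> ?I k" "x \<noteq> y" for x y
      using disjoint_family_onD[OF conjunct1[OF conjunct2[OF fk]] that] .
    have "(\<Union>x\<in>?I k. f k x) = (\<Union>j\<in>S - {k}. f k (Inl j)) \<union> (\<Union>i\<in>S - {k}. f k (Inr (S - {i})))"
      by auto
    then show eq: "deliver R k S = (\<Union>j\<in>S - {k}. f k (Inl j)) \<union> (\<Union>i\<in>S - {k}. f k (Inr (S - {i})))"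
      using fk by simp
    show "disjoint_family_on (\<lambda>j. f k (Inl j)) (S - {k})"
      unfolding disjoint_family_on_def using disj[OF inl inl] by blast
    show "disjoint_family_on (\<lambda>i. f k (Inr (S - {i}))) (S - {k})"
      unfolding disjoint_family_on_def
    proof (intro ballI impI)
      fix i i' assume "i \<in> S - {k}" "i' \<in> S - {k}" "i \<noteq> i'"
      then show "f k (Inr (S - {i})) \<inter> f k (Inr (S - {i'})) = {}"
        by (intro disj) auto
    qed
    show "(\<Union>j\<in>S - {k}. f k (Inl j)) \<inter> (\<Union>i\<in>S - {k}. f k (Inr (S - {i}))) = {}"
      using disj[OF inl inr] by blast
    fix j assume j: "j \<in> S - {k}"
    have "W k \<subseteq> {1..Q}" using W_subset k shuffle_setsD(1)[OF S] by blast
    \<comment> \<open>Every bit waiting for \<open>k\<close> at \<open>S\<close> is held by all of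
      \<open>S - {k}\<close>, in particular by \<open>j\<close>.\<close>
    then show "f k (Inl j) \<subseteq> local_bits K N Q T t D j"
      using eq j deliver_holders[OF assms k] by (fastforce simp: local_bits_iff)
    show "real (card (f k (Inl j))) = real T * real Q * L j S"
      using fk inl[OF j] l j by auto
    show "real (card (f k (Inr (S - {j})))) = real T * real Q * r k S (S - {j})"
      using fk inr[OF j] \<sigma>[OF k j] by auto
  qed
  then show ?thesis by blast
qed

section \<open>Executions preserve the invariant and never get stuck\<close>

lemma consistent_step:
  assumes "nested_step K N Q T W t D L r s s'" "consistent s"
  shows "consistent s'"
  using assms
proof cases
  case (process_subset S "done" R p \<rho> P)
  have rdy: "ready (insert S done) S"
    using process_subset(3,5) by (simp add: ready_def)
  \<comment> \<open>Only the residuals of the parents \<open>insert i U\<close> are read. For ready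
    \<open>U\<close> these are already in \<open>done\<close>, unlike \<open>S\<close>; for
    \<open>U = S\<close> they are strictly larger.\<close>
  have unchanged: "deliver (R(S := \<rho>)) k U = deliver R k U" if "ready done U \<or> U = S" for k U
  proof -
    have "insert i U \<noteq> S" if "i \<in> {1..K} - U" for i
      using ready_insert[of "done" U i] \<open>ready done U \<or> U = S\<close> process_subset(4) that by blast
    then show ?thesis by (auto simp: bits_to_deliver_def)
  qed
  show ?thesis
    unfolding process_subset(2) consistent_def case_prod_conv
  proof
    fix U assume U: "U \<in> insert S done"
    show "ready (insert S done) U \<and> valid_split K N Q T t D L r U
      (\<lambda>k. deliver (R(S := \<rho>)) k U) ((P(S := p)) U) ((R(S := \<rho>)) U)"
    proof (cases "U = S")
      case True
      then show ?thesis using rdy unchanged process_subset(6) by simp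
    next
      case False
      then have "U \<in> done" using U by blast
      then have "ready done U" "valid_split K N Q T t D L r U (\<lambda>k. deliver R k U) (P U) (R U)"
        using consistentD assms(2) process_subset(1) by auto
      then show ?thesis using False unchanged by (simp add: ready_def)
    qed
  qed
qed

lemma consistent_reachable:
  assumes "reachable K N Q T W t D L r s"
  shows "consistent s"
proof -
  have "(nested_step K N Q T W t D L r)\<^sup>*\<^sup>* initial_state s"
    using assms by (simp add: reachable_def)
  then show ?thesis
  proof induction
    case base
    then show ?case by (simp add: initial_state_def consistent_def)
  next
    case (step s s')
    then show ?case using consistent_step by blast
  qed
qed

text \<open>A largest unprocessed set is ready, hence can be split; the number of unprocessed sets
  decreases.\<close>

lemma complete_execution:
  assumes "consistent (done, P, R)"
  shows "\<exists>P' R'. (nested_step K N Q T W t D L r)\<^sup>*\<^sup>* (done, P, R) (shuffle_sets K, P', R')"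
  using assms
proof (induction "card (shuffle_sets K - done)" arbitrary: "done" P R rule: less_induct)
  case less
  have sub: "done \<subseteq> shuffle_sets K"
    using consistentD(1)[OF less.prems] ready_def by blast
  show ?case
  proof (cases "shuffle_sets K \<subseteq> done")
    case True
    then have "done = shuffle_sets K" using sub by blast
    then show ?thesis by blast
  next
    case False
    then have fin: "finite (shuffle_sets K - done)" "shuffle_sets K - done \<noteq> {}"
      using finite_shuffle_sets by auto
    have "Max (card ` (shuffle_sets K - done)) \<in> card ` (shuffle_sets K - done)"
      using fin by (intro Max_in) auto
    then obtain S where S: "S \<in> shuffle_sets K - done" "card S = Max (card ` (shuffle_sets K - done))"
      by force
    have max: "card S' \<le> card S" if "S' \<in> shuffle_sets K - done" for S'
      using S(2) fin that by simp
    have rdy: "ready done S" using S max by (fastforce simp: ready_def)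
    then obtain p \<rho> where split: "valid_split K N Q T t D L r S (\<lambda>k. deliver R k S) p \<rho>"
      using ex_split less.prems by blast
    have step: "nested_step K N Q T W t D L r (done, P, R) (insert S done, P(S := p), R(S := \<rho>))"
      using process_subset[OF _ _ _ split] S rdy by (simp add: ready_def)
    have "card (shuffle_sets K - insert S done) < card (shuffle_sets K - done)"
      using S fin by (intro psubset_card_mono) auto
    then show ?thesis
      using less.hyps consistent_step[OF step less.prems] step
      by (meson converse_rtranclp_into_rtranclp)
  qed
qed

lemma carried_out: "can_be_carried_out K N Q T W t D L r"
  unfolding can_be_carried_out_def using complete_execution consistent_reachable by (metis prod_cases3)

section \<open>Transmission, encoding and decoding\<close>

text \<open>A residual bit is handed to a smaller subset, and at size 2 there are no residuals, so every
  bit ends up in some part.\<close>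

lemma delivered_bit_sent:
  assumes "consistent (shuffle_sets K, P, R)" "S \<in> shuffle_sets K" "k \<in> S" "x \<in> deliver R k S"
  shows "\<exists>S\<in>shuffle_sets K. k \<in> S \<and> (\<exists>j\<in>S - {k}. x \<in> P S k j)"
  using assms(2-)
proof (induction "card S" arbitrary: S rule: less_induct)
  case less
  note S = less.prems(1) and k = less.prems(2)
  note split = consistentD(2)[OF assms(1) S]
  show ?case
  proof (cases "\<exists>j\<in>S - {k}. x \<in> P S k j")
    case True
    then show ?thesis using less.prems by blast
  next
    case False
    then obtain i where i: "i \<in> S - {k}" "x \<in> R S k (S - {i})"
      using valid_splitD(1)[OF split k] less.prems(3) by blast
    have "card S \<noteq> 2"
    proof
      assume "card S = 2"
      then have "card (R S k (S - {i})) = 0"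
        using valid_splitD(6)[OF split k i(1)] no_residual[OF S _ k i(1)] by simp
      moreover have "finite (R S k (S - {i}))"
      proof (rule finite_subset)
        show "R S k (S - {i}) \<subseteq> deliver R k S" using valid_splitD(1)[OF split k] i(1) by blast
      qed (rule finite_deliver[OF consistentD(1)[OF assms(1) S] assms(1) k])
      ultimately show False using i(2) by simp
    qed
    then have S': "S - {i} \<in> shuffle_sets K" and less': "card (S - {i}) < card S"
      using shuffle_setsD[OF S] i(1) by (auto simp: shuffle_sets_def)
    have "insert i (S - {i}) = S" "i \<in> {1..K} - (S - {i})"
      using i(1) shuffle_setsD(1)[OF S] by blast+
    then have "x \<in> deliver R k (S - {i})"
      using i(2) unfolding bits_to_deliver_def by (auto intro!: bexI[of _ i])
    then show ?thesis using less.hyps[OF less' S'] i(1) k by blast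
  qed
qed

lemma bit_value_local:
  assumes "computed_ivs K N Q t D j V = computed_ivs K N Q t D j V'" "x \<in> local_bits K N Q T t D j"
  shows "bit_value V x = bit_value V' x"
proof -
  obtain q n b where x: "x = (q, n, b)" by (cases x) auto
  have "q \<in> {1..Q} \<and> n \<in> D \<inter> stored_files K N t j"
    using assms(2) by (simp add: x local_bits_def iv_bits_def)
  then have "Some (V q n) = Some (V' q n)"
    using fun_cong[OF fun_cong[OF assms(1), of q], of n] by (simp add: computed_ivs_def)
  then show ?thesis by (simp add: x bit_value_def)
qed

text \<open>All strings combined in one message thus have its length, and no index in
  \<open>coded_message\<close> is out of range.\<close>

lemma length_agreed:
  assumes "consistent (shuffle_sets K, P, R)" "agreed_order K P B"
    "S \<in> shuffle_sets K" "k \<in> S" "j \<in> S - {k}"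
  shows "length (B S k j) = nat \<lfloor>real T * real Q * L j S\<rfloor>"
proof -
  have "length (B S k j) = card (P S k j)"
    using assms(2-5) distinct_card unfolding agreed_order_def by metis
  then show ?thesis
    using valid_splitD(5)[OF consistentD(2)[OF assms(1,3)] assms(4,5)] by (metis floor_of_nat nat_int)
qed

text \<open>Here \<open>k\<close> is any member of \<open>S\<close> other than the addressee
  \<open>l\<close>: the sender \<open>j\<close> when encoding, another receiver when removing
  interference.\<close>

lemma part_local:
  assumes "consistent (shuffle_sets K, P, R)" "S \<in> shuffle_sets K"
    "l \<in> S" "j \<in> S - {l}" "k \<in> S - {l}"
  shows "P S l j \<subseteq> local_bits K N Q T t D k"
proof
  fix x assume x: "x \<in> P S l j"
  obtain q n b where eq: "x = (q, n, b)" by (cases x) auto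
  have "W l \<subseteq> {1..Q}" using W_subset assms(3) shuffle_setsD(1)[OF assms(2)] by blast
  moreover have "x \<in> deliver R l S"
    using valid_splitD(3)[OF consistentD(2)[OF assms(1,2)] assms(3,4)] x by blast
  ultimately show "x \<in> local_bits K N Q T t D k"
    using deliver_holders[OF consistentD(1)[OF assms(1,2)] assms(1,3), of q n b] assms(5) eq
    by (auto simp: local_bits_iff)
qed

lemma encode:
  assumes "consistent (shuffle_sets K, P, R)" "agreed_order K P B" "S \<in> shuffle_sets K" "j \<in> S"
  shows "can_encode K N Q T t D L B S j"
  unfolding can_encode_def
proof (rule factors_through)
  fix V V' assume eq: "computed_ivs K N Q t D j V = computed_ivs K N Q t D j V'"
  have "map (bit_value V) (B S k j) = map (bit_value V') (B S k j)" if k: "k \<in> S - {j}" for k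
  proof (rule map_cong[OF refl])
    fix x assume "x \<in> set (B S k j)"
    then have "x \<in> P S k j" using assms k by (auto simp: agreed_order_def)
    then show "bit_value V x = bit_value V' x"
      using bit_value_local[OF eq] part_local[OF assms(1,3), of k j j] assms(4) k by blast
  qed
  then show "coded_message Q T L B V S j = coded_message Q T L B V' S j"
    unfolding coded_message_def by (intro map_cong sum.cong refl) (metis)
qed

text \<open>In the message of \<open>j\<close> for \<open>S\<close>, worker \<open>k\<close> stores every interfering bit, as the parts destined
  to \<open>l\<close> consist of bits held by all of \<open>S - {l}\<close>.\<close>

lemma sent_bit_determined:
  assumes "consistent (shuffle_sets K, P, R)" "agreed_order K P B" "S \<in> shuffle_sets K"
    "k \<in> S" "j \<in> S - {k}" "x \<in> P S k j"
    "computed_ivs K N Q t D k V = computed_ivs K N Q t D k V'"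
    "received_messages K Q T L B k V = received_messages K Q T L B k V'"
  shows "bit_value V x = bit_value V' x"
proof -
  have len: "length (B S l j) = nat \<lfloor>real T * real Q * L j S\<rfloor>" if "l \<in> S - {j}" for l
    using length_agreed[OF assms(1,2,3)] that assms(5) by auto
  have k: "k \<in> S - {j}" using assms by blast
  obtain m where m: "m < length (B S k j)" "B S k j ! m = x"
    using assms(2-6) unfolding agreed_order_def by (metis in_set_conv_nth)
  have "Some (coded_message Q T L B V S j) = Some (coded_message Q T L B V' S j)"
    using fun_cong[OF fun_cong[OF assms(8), of S], of j] assms(3-5)
    by (auto simp: received_messages_def)
  then have "coded_message Q T L B V S j ! m = coded_message Q T L B V' S j ! m" by simp
  then have sums: "(\<Sum>l\<in>S - {j}. bit_value V (B S l j ! m)) = (\<Sum>l\<in>S - {j}. bit_value V' (B S l j ! m))"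
    using m(1) len k by (simp add: coded_message_def)
  have "(\<Sum>l\<in>S - {j} - {k}. bit_value V (B S l j ! m)) = (\<Sum>l\<in>S - {j} - {k}. bit_value V' (B S l j ! m))"
  proof (rule sum.cong[OF refl])
    fix l assume l: "l \<in> S - {j} - {k}"
    then have "B S l j ! m \<in> P S l j"
      using assms(2,3,5) m(1) len[of l] len[OF k] nth_mem[of m "B S l j"] by (auto simp: agreed_order_def)
    then show "bit_value V (B S l j ! m) = bit_value V' (B S l j ! m)"
      using bit_value_local[OF assms(7)] part_local[OF assms(1,3), of l j k] assms(4,5) l by blast
  qed
  moreover have "finite (S - {j})" using shuffle_setsD(2)[OF assms(3)] by blast
  \<comment> \<open>Splitting off the summand of \<open>k\<close> and cancelling the rest amounts to
    XORing the known bits out of the message.\<close>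
  ultimately have "bit_value V (B S k j ! m) = bit_value V' (B S k j ! m)"
    using sums unfolding sum.remove[OF \<open>finite (S - {j})\<close> k] by (metis add_right_cancel)
  then show ?thesis using m(2) by simp
qed

text \<open>By \<open>factors_through\<close> it suffices that assignments with the same view for
  \<open>k\<close> agree on each missing IV, which is checked bit by bit.\<close>

lemma recover:
  assumes "consistent (shuffle_sets K, P, R)" "agreed_order K P B" "k \<in> {1..K}"
  shows "can_recover K N Q T W t D L B k"
proof -
  let ?g = "\<lambda>V. (computed_ivs K N Q t D k V, received_messages K Q T L B k V)"
  \<comment> \<open>The default \<open>[]\<close> makes the target independent of IVs that need not
    be recovered.\<close>
  let ?h = "\<lambda>V q n. if q \<in> W k \<and> n \<in> D - stored_files K N t k then V q n else []"
  have "\<exists>f. \<forall>V. iv_assignment Q T D V \<longrightarrow> f (?g V) = ?h V"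
  proof (rule factors_through)
    fix V V' assume V: "iv_assignment Q T D V" "iv_assignment Q T D V'" and eq: "?g V = ?g V'"
    have "V q n = V' q n" if q: "q \<in> W k" and n: "n \<in> D - stored_files K N t k" for q n
    proof (rule nth_equalityI)
      have "q \<in> {1..Q}" using q W_subset assms(3) by blast
      then have len: "length (V q n) = T" "length (V' q n) = T"
        using V n by (auto simp: iv_assignment_def)
      then show "length (V q n) = length (V' q n)" by simp
      fix b assume b: "b < length (V q n)"
      \<comment> \<open>The set at which the bits of file \<open>n\<close> enter the procedure for
        \<open>k\<close>.\<close>
      let ?S = "insert k (holders n)"
      have kn: "k \<notin> holders n" using n stored_iff_holders by blast
      have hs: "holders n \<noteq> {}" "holders n \<subseteq> {1..K}"
        using n holders_nonempty holders_subset by blast+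
      then have "finite (holders n)" using finite_subset by blast
      then have "card ?S \<ge> 2" using kn hs card_gt_0_iff[of "holders n"] by simp
      then have S: "?S \<in> shuffle_sets K" using hs assms(3) by (simp add: shuffle_sets_def)
      have "(q, n, b) \<in> deliver R k ?S"
        using deliver_iff[OF S] q n b len kn by auto
      then obtain S j where "S \<in> shuffle_sets K" "k \<in> S" "j \<in> S - {k}" "(q, n, b) \<in> P S k j"
        using delivered_bit_sent[OF assms(1) S] by blast
      then have "bit_value V (q, n, b) = bit_value V' (q, n, b)"
        using sent_bit_determined[OF assms(1,2)] eq by blast
      then show "V q n ! b = V' q n ! b" by (simp add: bit_value_def)
    qed
    then show "?h V = ?h V'" by (intro ext) simp
  qed
  then obtain f where f: "\<And>V. iv_assignment Q T D V \<Longrightarrow> f (?g V) = ?h V" by blast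
  show ?thesis
    unfolding can_recover_def
  proof (intro exI allI impI ballI)
    fix V q n assume V: "iv_assignment Q T D V" and qn: "q \<in> W k" "n \<in> D - stored_files K N t k"
    show "(\<lambda>c m. f (c, m)) (computed_ivs K N Q t D k V) (received_messages K Q T L B k V) q n = V q n"
      using fun_cong[OF fun_cong[OF f[OF V], of q], of n] qn by simp
  qed
qed

end

section \<open>Existence of feasible parameters\<close>

context nested_shuffling
begin

text \<open>The parameters of the scheme without coding gain: above size 2 everything destined to \<open>k\<close> is
  passed on, from \<open>S\<close> to \<open>S - {Min (S - {k})}\<close>. The first argument is \<open>K - card S\<close>.\<close>

fun pending :: "nat \<Rightarrow> nat \<Rightarrow> nat set \<Rightarrow> real" where
  "pending 0 k S = reducing_load Q W k * (\<Sum>n\<in>D. real (t n (S - {k})))"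
| "pending (Suc d) k S = reducing_load Q W k * (\<Sum>n\<in>D. real (t n (S - {k}))) +
     (\<Sum>i\<in>{1..K} - S. if i = Min (insert i S - {k}) then pending d k (insert i S) else 0)"

lemma pending_nonneg: "pending d k S \<ge> 0"
  by (induction d arbitrary: S)
    (auto simp: reducing_load_def
      intro!: add_nonneg_nonneg sum_nonneg mult_nonneg_nonneg divide_nonneg_nonneg)

lemma demand_integral:
  "real T * real Q * (reducing_load Q W k * (\<Sum>n\<in>D. real (t n A))) \<in> \<int>"
proof -
  have "real T * real Q * (reducing_load Q W k * (\<Sum>n\<in>D. real (t n A)))
      = real (T * card (W k) * (\<Sum>n\<in>D. t n A))"
    using Q_pos by (simp add: reducing_load_def)
  then show ?thesis by (metis Ints_of_nat)
qed

lemma pending_integral: "real T * real Q * pending d k S \<in> \<int>"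
proof (induction d arbitrary: S)
  case 0
  show ?case using demand_integral by simp
next
  case (Suc d)
  have "(\<Sum>i\<in>{1..K} - S. real T * real Q *
      (if i = Min (insert i S - {k}) then pending d k (insert i S) else 0)) \<in> \<int>"
    using Suc by (intro Ints_sum) simp
  then show ?case
    unfolding pending.simps distrib_left[of "real T * real Q"] sum_distrib_left[of "real T * real Q"]
    by (rule Ints_add[OF demand_integral])
qed

text \<open>Both sides of the constraint equal the amount pending for \<open>k\<close> at
  \<open>S\<close>: on the left as inflow, by the recursion of \<open>pending\<close>; on the right
  as outflow, by a single residual, or by a single transmission at size 2.\<close>

lemma ex_feasible: "\<exists>L r. feasible K Q T W t D L r"
proof -
  let ?x = "\<lambda>k S. pending (K - card S) k S"
  define r where "r k S U = (if card S \<noteq> 2 \<and> U = S - {Min (S - {k})} then ?x k S else 0)" for k S U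
  \<comment> \<open>At size 2 the sum has one term and merely names the only receiver.\<close>
  define L where "L j S = (if card S = 2 then \<Sum>k\<in>S - {j}. ?x k S else 0)" for j S
  have "shuffling_parameters K Q T L r"
    using pending_nonneg pending_integral
    by (auto simp: shuffling_parameters_def L_def r_def sum_distrib_left intro!: sum_nonneg Ints_sum)
  moreover have "reducing_load Q W k * (\<Sum>n\<in>D. real (t n (S - {k})))
      + (\<Sum>i\<in>{1..K} - S. r k (S \<union> {i}) S) = (\<Sum>j\<in>S - {k}. L j S) + (\<Sum>i\<in>S - {k}. r k S (S - {i}))"
    if S: "S \<in> shuffle_sets K" and k: "k \<in> S" for S k
  proof -
    note fin = shuffle_setsD(2)[OF S]
    have le: "card S \<le> K" using card_mono[of "{1..K}" S] shuffle_setsD(1)[OF S] by simp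
    \<comment> \<open>A parent passes its load to \<open>S\<close> only if the added worker is the
      minimum it drops, which is the condition in \<open>pending\<close>.\<close>
    have r_up: "r k (insert i S) S =
        (if i = Min (insert i S - {k}) then ?x k (insert i S) else 0)" if i: "i \<in> {1..K} - S" for i
    proof -
      have "card (insert i S) \<noteq> 2"
        using insert_shuffle_sets(2)[OF S i] shuffle_setsD(3)[OF S] by simp
      moreover have "S = insert i S - {m} \<longleftrightarrow> m = i" for m using i by blast
      ultimately show ?thesis by (auto simp: r_def)
    qed
    have left: "?x k S = reducing_load Q W k * (\<Sum>n\<in>D. real (t n (S - {k})))
      + (\<Sum>i\<in>{1..K} - S. r k (S \<union> {i}) S)"
    proof (cases "card S = K")
      case True
      \<comment> \<open>There are no parents, matching the base clause of
        \<open>pending\<close>.\<close>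
      then have "S = {1..K}" using card_subset_eq[of "{1..K}" S] shuffle_setsD(1)[OF S] by simp
      then show ?thesis by simp
    next
      case False
      \<comment> \<open>Adding a worker lowers the depth argument by exactly one, so the recursive
        clause applies.\<close>
      then have "K - card S = Suc (K - Suc (card S))" using le by simp
      then have "?x k S = reducing_load Q W k * (\<Sum>n\<in>D. real (t n (S - {k}))) +
          (\<Sum>i\<in>{1..K} - S. if i = Min (insert i S - {k}) then pending (K - Suc (card S)) k (insert i S) else 0)"
        by simp
      also have "(\<Sum>i\<in>{1..K} - S. if i = Min (insert i S - {k}) then pending (K - Suc (card S)) k (insert i S) else 0)
          = (\<Sum>i\<in>{1..K} - S. r k (S \<union> {i}) S)"
        using r_up insert_shuffle_sets(2)[OF S] by (intro sum.cong) auto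
      finally show ?thesis .
    qed
    have right: "?x k S = (\<Sum>j\<in>S - {k}. L j S) + (\<Sum>i\<in>S - {k}. r k S (S - {i}))"
    proof (cases "card S = 2")
      case True
      then have "card (S - {k}) = 1" using fin k by simp
      then obtain j where j: "S - {k} = {j}" using card_1_singletonE by blast
      then have "S - {j} = {k}" using k by blast
      then show ?thesis using j True by (simp add: L_def r_def)
    next
      case False
      let ?m = "Min (S - {k})"
      have m: "?m \<in> S - {k}" using remove_nonempty[OF S] fin by (intro Min_in) auto
      have "r k S (S - {i}) = (if i = ?m then ?x k S else 0)" if "i \<in> S - {k}" for i
      proof -
        have "S - {i} = S - {?m} \<longleftrightarrow> i = ?m" using that m by blast
        then show ?thesis using False by (simp add: r_def)
      qed
      then have "(\<Sum>i\<in>S - {k}. r k S (S - {i})) = (\<Sum>i\<in>S - {k}. if i = ?m then ?x k S else 0)"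
        by (intro sum.cong) auto
      also have "\<dots> = ?x k S" using m fin by (simp add: sum.delta')
      finally show ?thesis using False by (simp add: L_def)
    qed
    show ?thesis using left right by simp
  qed
  ultimately have "feasible K Q T W t D L r" by (simp add: feasible_def)
  then show ?thesis by blast
qed

end

theorem proposition1:
  fixes K N Q T :: nat
    and p :: "nat \<Rightarrow> real"
    and M :: "nat \<Rightarrow> nat"
    and W :: "nat \<Rightarrow> nat set"
    and t :: "nat \<Rightarrow> nat set \<Rightarrow> nat"
    and D :: "nat set"
  assumes "K \<ge> 1" and "N \<ge> 1" and "Q \<ge> 1"
    and "\<forall>n\<in>{1..N}. p n \<ge> 0"
    and "\<forall>m\<in>{1..N}. \<forall>n\<in>{1..N}. m \<le> n \<longrightarrow> p n \<le> p m"
    and "(\<Sum>n=1..N. p n) = 1"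
    and "\<forall>k\<in>{1..K}. M k \<ge> 1"
    and "(\<Sum>k=1..K. M k) \<ge> N"
    and "(\<Union>k\<in>{1..K}. W k) = {1..Q}"
    and "disjoint_family_on W {1..K}"
    and "file_placement K N M t"
    and "D \<noteq> {}" and "D \<subseteq> {1..N}"
  shows "(\<exists>L r. feasible K Q T W t D L r) \<and>
    (\<forall>L r. feasible K Q T W t D L r \<longrightarrow>
       can_be_carried_out K N Q T W t D L r \<and>
       (\<forall>P R B. reachable K N Q T W t D L r (shuffle_sets K, P, R) \<and> agreed_order K P B \<longrightarrow>
          (\<forall>S\<in>shuffle_sets K. \<forall>j\<in>S. can_encode K N Q T t D L B S j) \<and>
          (\<forall>k\<in>{1..K}. can_recover K N Q T W t D L B k)))"
proof -
  interpret nested_shuffling K N Q T M W t D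
    using assms by unfold_locales
  have "can_be_carried_out K N Q T W t D L r \<and>
       (\<forall>P R B. reachable K N Q T W t D L r (shuffle_sets K, P, R) \<and> agreed_order K P B \<longrightarrow>
          (\<forall>S\<in>shuffle_sets K. \<forall>j\<in>S. can_encode K N Q T t D L B S j) \<and>
          (\<forall>k\<in>{1..K}. can_recover K N Q T W t D L B k))"
    if "feasible K Q T W t D L r" for L r
  proof -
    interpret parametrized_shuffling K N Q T M W t D L r
      using that by unfold_locales
    show ?thesis
      \<comment> \<open>Whatever splits were chosen, a reachable final state is consistent, which is
        all that \<open>encode\<close> and \<open>recover\<close> ask of it.\<close>
      using carried_out consistent_reachable encode recover by blast
  qed
  then show ?thesis using ex_feasible by blast
qed

end
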